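(* Let $C(n)$ denote the maximum number of touching pairs among all packings of $n$ congruent spheres in $\mathbb{R}^3$. Then $$C(7)=15.$$
   Context: A packing of $n$ congruent spheres in $\mathbb{R}^3$ is a family of $n$ spheres $x_i+\mathbb{S}^2$ ($1\le i\le n$, $x_i\in\mathbb{R}^3$, where $\mathbb{S}^2$ is the unit sphere centered at the origin) bounding closed unit balls with pairwise disjoint interiors; equivalently, $\|x_i-x_j\|\ge 2$ for all $i\ne j$. A touching pair is an unordered pair $\{i,j\}$ with $i\neq j$ such that the two spheres are tangent, i.e. $\|x_i-x_j\|=2$. The contact number $C(n)$ is the maximum, over all such packings of $n$ spheres, of the number of touching pairs. *)

theory Defs
  imports "HOL-Analysis.Analysis"
begin

(* A packing is given by its centres x 1, ..., x n; values of x outside {1..n} are irrelevant.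
   All spheres have radius 1. *)
definition sphere_packing :: "nat \<Rightarrow> (nat \<Rightarrow> real ^ 3) \<Rightarrow> bool" where
  "sphere_packing n x \<longleftrightarrow> disjoint_family_on (\<lambda>i. interior (cball (x i) 1)) {1..n}"

definition touching_pairs :: "nat \<Rightarrow> (nat \<Rightarrow> real ^ 3) \<Rightarrow> nat set set" where
  "touching_pairs n x = {{i, j} | i j. i \<in> {1..n} \<and> j \<in> {1..n} \<and> i \<noteq> j \<and> dist (x i) (x j) = 2}"

(* Max is only meaningful on finite nonempty sets; see contact_numbers_finite and
   contact_numbers_nonempty below. *)
definition contact_number :: "nat \<Rightarrow> nat" where
  "contact_number n = Max {card (touching_pairs n x) | x. sphere_packing n x}"

lemma sphere_packing_iff_dist:
  "sphere_packing n x \<longleftrightarrow> (\<forall>i\<in>{1..n}. \<forall>j\<in>{1..n}. i \<noteq> j \<longrightarrow> dist (x i) (x j) \<ge> 2)"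
proof -
  have "ball a 1 \<inter> ball b 1 = {} \<longleftrightarrow> dist a b \<ge> 2" for a b :: "real ^ 3"
  proof
    assume disj: "ball a 1 \<inter> ball b 1 = {}"
    show "dist a b \<ge> 2"
    proof (rule ccontr)
      assume "\<not> dist a b \<ge> 2"
      then have "midpoint a b \<in> ball a 1 \<inter> ball b 1"
        by (simp add: dist_midpoint)
      with disj show False by blast
    qed
  next
    assume "dist a b \<ge> 2"
    then show "ball a 1 \<inter> ball b 1 = {}"
      by (intro disjoint_ballI) simp
  qed
  then show ?thesis
    by (simp add: sphere_packing_def disjoint_family_on_def interior_cball)
qed

lemma contact_numbers_finite: "finite {card (touching_pairs n x) | x. sphere_packing n x}"
proof (rule finite_subset)
  show "{card (touching_pairs n x) | x. sphere_packing n x} \<subseteq> card ` Pow (Pow {1..n})"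
    unfolding touching_pairs_def by fastforce
qed simp

lemma contact_numbers_nonempty: "{card (touching_pairs n x) | x. sphere_packing n x} \<noteq> {}"
proof -
  define x :: "nat \<Rightarrow> real ^ 3" where "x i = (2 * real i) *\<^sub>R axis 1 1" for i
  have "dist (x i) (x j) = 2 * \<bar>real i - real j\<bar>" for i j
    by (simp add: x_def dist_norm scaleR_left_diff_distrib[symmetric] abs_if)
  then have "sphere_packing n x"
    by (auto simp: sphere_packing_iff_dist)
  then show ?thesis by blast
qed

end

theory Submission
  imports Defs
begin

text \<open>
  Octahedra and tetrahedra of edge length 2 give the lower bound: the six vertices of a regular
  octahedron touch along its 12 edges, and a seventh sphere resting on a face adds 3 contacts
  (lemma \<open>capped_octahedron\<close>).

  For the upper bound, regard the centres as the vertices of a graph whose edges are the contacts.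
  Three configurations of points in space are impossible, whatever the common distance:

  \<^item> two disjoint triples with all nine cross distances equal
    (\<open>no_equidistant_triples\<close>): points with the same distance to three given points lie on a line
    perpendicular to the plane of these, and a line meets a sphere at most twice;
  \<^item> five mutually equidistant points (\<open>no_five_equidistant_points\<close>);
  \<^item> five regular tetrahedra closing up cyclically around a common edge
    (\<open>no_five_tetrahedra_around_edge\<close>): the dihedral angle of about 70.5 degrees is just short
    of a fifth of a full turn.

  A graph on seven vertices with 16 edges misses only 5 of the 21 pairs, and
  \<open>dense_graph_on_seven_vertices\<close> shows by pure combinatorics that it contains one of the three:
  a complete bipartite graph on 3 + 3 vertices, a complete graph on 5 vertices, or, if the missing
  pairs form a pentagon, the complementary pentagon joined to the edge of the other two vertices.
  So 16 contacts are impossible.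
\<close>

section \<open>Points with equal distances in space\<close>

unbundle cross3_syntax

text \<open>Both points lie on the hyperplane bisecting the segment from \<open>a\<close> to \<open>b\<close>, for which \<open>a - b\<close> is a
  normal vector.\<close>

lemma equidistant_imp_orthogonal:
  fixes p q a b :: "'a::real_inner"
  assumes "dist p a = dist p b" "dist q a = dist q b"
  shows "(p - q) \<bullet> (a - b) = 0"
proof -
  have "(p - a) \<bullet> (p - a) = (p - b) \<bullet> (p - b)" "(q - a) \<bullet> (q - a) = (q - b) \<bullet> (q - b)"
    using assms by (simp_all add: dist_norm norm_eq)
  then show ?thesis by (simp add: inner_simps inner_commute)
qed

text \<open>A line meets a sphere in at most two points: on the line through \<open>a\<close> and \<open>b\<close>, parametrised from
  \<open>a\<close>, the distance to the centre takes the same value as at \<open>a\<close> for just one other parameter,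
  by a quadratic equation.\<close>

lemma cospherical_not_collinear:
  fixes a b c p :: "real ^ 3"
  assumes "a \<noteq> b" "a \<noteq> c" "b \<noteq> c" "dist p a = l" "dist p b = l" "dist p c = l"
  shows "(a - b) \<times> (a - c) \<noteq> 0"
proof
  assume "(a - b) \<times> (a - c) = 0"
  then obtain k where k: "a - c = k *\<^sub>R (a - b)"
    using assms unfolding cross_eq_0 collinear_lemma by (metis right_minus_eq)
  define y s where "y = p - a" and "s = a - b"
  have "p - b = y + s" "p - c = y + k *\<^sub>R s"
    unfolding y_def s_def k[symmetric] by simp_all
  then have "norm (y + s) = norm y" "norm (y + k *\<^sub>R s) = norm y"
    using assms by (metis dist_norm y_def)+
  then have "(y + s) \<bullet> (y + s) = y \<bullet> y" "(y + k *\<^sub>R s) \<bullet> (y + k *\<^sub>R s) = y \<bullet> y"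
    by (simp_all only: norm_eq)
  then have 1: "2 * (y \<bullet> s) + s \<bullet> s = 0" and 2: "k * (2 * (y \<bullet> s) + k * (s \<bullet> s)) = 0"
    by (simp_all add: inner_add_left inner_add_right inner_commute[of s y] distrib_left)
  have "k * (k - 1) * (s \<bullet> s) = 0"
    using 1 2 by algebra
  moreover have "s \<bullet> s \<noteq> 0" using assms by (simp add: s_def)
  ultimately have "k = 0 \<or> k = 1" by simp
  then show False using k assms by auto
qed

lemma common_normals_parallel:
  fixes s t u w :: "real ^ 3"
  assumes "s \<times> t \<noteq> 0" "u \<bullet> s = 0" "u \<bullet> t = 0" "w \<bullet> s = 0" "w \<bullet> t = 0"
  shows "u \<times> w = 0"
proof -
  have "(s \<times> t) \<times> v = 0" if "v \<bullet> s = 0" "v \<bullet> t = 0" for v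
    using that by (subst cross_skew) (simp add: Lagrange)
  then have "\<exists>k. v = k *\<^sub>R (s \<times> t)" if "v \<bullet> s = 0" "v \<bullet> t = 0" for v
    using that assms(1) unfolding cross_eq_0 collinear_lemma by (metis scaleR_zero_left)
  then obtain i j where "u = i *\<^sub>R (s \<times> t)" "w = j *\<^sub>R (s \<times> t)"
    using assms by meson
  then show ?thesis by (simp add: cross_mult_left cross_mult_right)
qed

text \<open>The complete bipartite graph on 3 + 3 vertices is not a unit distance graph in space. All
  differences within one triple are orthogonal to all differences within the other one. As neither
  triple is collinear, these differences would span two orthogonal planes through the origin, which
  needs four dimensions.\<close>

lemma no_equidistant_triples:
  fixes a b c p q r :: "real ^ 3"
  assumes "a \<noteq> b" "a \<noteq> c" "b \<noteq> c" "p \<noteq> q" "p \<noteq> r" "q \<noteq> r"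
    and d: "\<And>x y. x \<in> {a, b, c} \<Longrightarrow> y \<in> {p, q, r} \<Longrightarrow> dist x y = l"
  shows False
proof -
  have d': "dist y x = l" if "x \<in> {a, b, c}" "y \<in> {p, q, r}" for x y
    using d[OF that] by (simp add: dist_commute)
  have "(a - b) \<times> (a - c) \<noteq> 0" "(p - q) \<times> (p - r) \<noteq> 0"
    using assms by (intro cospherical_not_collinear[where l = l and p = p]
      cospherical_not_collinear[where l = l and p = a]; auto simp: d d')+
  moreover have "(p - q) \<times> (p - r) = 0" if "(a - b) \<times> (a - c) \<noteq> 0"
    by (rule common_normals_parallel[OF that]; rule equidistant_imp_orthogonal; simp add: d')
  ultimately show False by blast
qed

text \<open>The two apices that complete the equilateral triangle \<open>a b q\<close> to a tetrahedron with equal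
  lateral edges are mirror images in the plane of the triangle, so their midpoint is its centroid.
  This turns distance conditions into linear recursions. In the proof, the defect \<open>z\<close> of the
  equation is orthogonal both to the plane of the triangle and to \<open>p - r\<close>, which is itself normal to
  that plane; so it vanishes.\<close>

lemma tetrahedra_on_common_face:
  fixes a b q p r :: "real ^ 3"
  assumes "p \<noteq> r" "a \<noteq> b"
    and abq: "dist a b = l" "dist a q = l" "dist b q = l"
    and p: "dist p a = m" "dist p b = m" "dist p q = m"
    and r: "dist r a = m" "dist r b = m" "dist r q = m"
  shows "p + r = (2/3) *\<^sub>R (a + b + q)"
proof -
  define z where "z = p + r - (2/3) *\<^sub>R (a + b + q)"
  have "a \<noteq> q" "b \<noteq> q" using assms by auto
  then have n: "(a - b) \<times> (a - q) \<noteq> 0"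
    using assms by (intro cospherical_not_collinear[where l = m and p = p]) auto
  have sq: "(x - y) \<bullet> (x - y) = t\<^sup>2" if "dist x y = t" for x y :: "real^3" and t
    using that by (simp add: dist_norm power2_norm_eq_inner[symmetric])
  note eqs = abq[THEN sq] p[THEN sq] r[THEN sq]
  have perp: "(p - r) \<bullet> (a - b) = 0" "(p - r) \<bullet> (a - q) = 0"
    by (rule equidistant_imp_orthogonal; simp add: assms)+
  have zs: "z \<bullet> (a - b) = 0" "z \<bullet> (a - q) = 0" "z \<bullet> (p - r) = 0"
    using eqs perp unfolding z_def by (simp_all add: inner_simps inner_commute field_simps)
  have "z \<times> (p - r) = 0"
    using n zs perp by (intro common_normals_parallel)
  then have "norm z * norm (p - r) = 0"
    using zs(3) norm_cross_dot[of z "p - r"] by simp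
  then have "z = 0" using assms by simp
  then show ?thesis by (simp add: z_def)
qed

lemma inner_of_equilateral:
  fixes a x y :: "'a::real_inner"
  assumes "dist a x = l" "dist a y = l" "dist x y = l"
  shows "(x - a) \<bullet> (y - a) = l\<^sup>2 / 2"
proof -
  have "(norm ((x - a) - (y - a)))\<^sup>2 = (norm (x - a))\<^sup>2 + (norm (y - a))\<^sup>2 - 2 * ((x - a) \<bullet> (y - a))"
    by (simp add: power2_norm_eq_inner inner_diff_left inner_diff_right inner_commute)
  then show ?thesis
    using assms by (simp add: dist_norm norm_minus_commute)
qed

text \<open>With the vertex \<open>a\<close> as origin the reflection law loses its constant term, so that inner
  products can be taken with it directly.\<close>

lemma reflection_seen_from_vertex:
  fixes a b q p r :: "'a::real_vector"
  assumes "p + r = (2/3) *\<^sub>R (a + b + q)"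
  shows "(p - a) + (r - a) = (2/3) *\<^sub>R ((b - a) + (q - a))"
proof -
  have "(p - a) + (r - a) = (p + r) - 2 *\<^sub>R a"
    by (simp add: scaleR_2)
  also have "\<dots> = (2/3) *\<^sub>R ((a + b + q) - 3 *\<^sub>R a)"
    by (simp only: assms scaleR_diff_right scaleR_scaleR) simp
  also have "(a + b + q) - 3 *\<^sub>R a = (b - a) + (q - a)"
    using scaleR_left_distrib[of 2 1 a] by (simp add: scaleR_2)
  finally show ?thesis .
qed

text \<open>Two of the five points would be the two apices over the triangle of the others, and the
  reflection law makes the distance of these apices different from \<open>l\<close>: with \<open>a\<close> as origin, its
  inner product with \<open>p - a\<close> would read \<open>3/2 = 2/3\<close> in units of \<open>l\<^sup>2\<close>.\<close>

lemma no_five_equidistant_points: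
  fixes a b c p r :: "real ^ 3"
  assumes "l > 0"
    and "dist a b = l" "dist a c = l" "dist b c = l"
    and "dist p a = l" "dist p b = l" "dist p c = l"
    and "dist r a = l" "dist r b = l" "dist r c = l"
  shows "dist p r \<noteq> l"
proof
  assume pr: "dist p r = l"
  then have "p + r = (2/3) *\<^sub>R (a + b + c)"
    using assms by (intro tetrahedra_on_common_face[where l = l and m = l]) auto
  then have "(p - a) + (r - a) = (2/3) *\<^sub>R ((b - a) + (c - a))"
    by (rule reflection_seen_from_vertex)
  then have "(p - a) \<bullet> (p - a) + (p - a) \<bullet> (r - a) =
      (2/3) * ((p - a) \<bullet> (b - a) + (p - a) \<bullet> (c - a))"
    unfolding inner_add_right[symmetric] by simp
  moreover have "(p - a) \<bullet> (p - a) = l\<^sup>2"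
    using assms by (simp add: dist_norm flip: power2_norm_eq_inner)
  moreover have "(p - a) \<bullet> (x - a) = l\<^sup>2 / 2" if "x \<in> {r, b, c}" for x
    using that assms pr by (intro inner_of_equilateral) (auto simp: dist_commute)
  ultimately show False using assms(1) by simp
qed

text \<open>Around the edge from \<open>a\<close> to \<open>b\<close>, consecutive points span regular tetrahedra with this edge,
  so each point is determined by the two before it through the reflection law. The condition that
  \<open>c i\<close> differs from \<open>c (i + 2)\<close> excludes turning back. In units of \<open>l\<^sup>2\<close>, the inner products of
  \<open>c i - a\<close> with \<open>c 0 - a\<close> are then \<open>1, 1/2, -1/3, -7/18, 11/27\<close>, whereas a cycle would close up
  only with last value \<open>1/2\<close>.\<close>

lemma no_five_tetrahedra_around_edge:
  fixes a b :: "real ^ 3" and c :: "nat \<Rightarrow> real ^ 3"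
  assumes "l > 0" "dist a b = l" "\<And>i. i < 5 \<Longrightarrow> dist a (c i) = l" "\<And>i. i < 5 \<Longrightarrow> dist b (c i) = l"
   and cc: "\<And>i. i < 4 \<Longrightarrow> dist (c i) (c (Suc i)) = l" and "\<And>i. i < 3 \<Longrightarrow> c i \<noteq> c (i + 2)"
 shows "dist (c 0) (c 4) \<noteq> l"
proof
  assume "dist (c 0) (c 4) = l"
  define g where "g i = (c 0 - a) \<bullet> (c i - a)" for i
  have rec: "g (i + 2) = (2/3) * (l\<^sup>2 / 2 + g (i + 1)) - g i" if "i < 3" for i
  proof -
    have "c i + c (i + 2) = (2/3) *\<^sub>R (a + b + c (i + 1))"
      using that assms cc[of "Suc i"]
      by (intro tetrahedra_on_common_face[where l = l and m = l]) (auto simp: dist_commute)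
    then have "(c i - a) + (c (i + 2) - a) = (2/3) *\<^sub>R ((b - a) + (c (i + 1) - a))"
      by (rule reflection_seen_from_vertex)
    then have "g i + g (i + 2) = (2/3) * ((c 0 - a) \<bullet> (b - a) + g (i + 1))"
      unfolding g_def inner_add_right[symmetric] by simp
    moreover have "(c 0 - a) \<bullet> (b - a) = l\<^sup>2 / 2"
      using assms by (intro inner_of_equilateral) (auto simp: dist_commute)
    ultimately show ?thesis by (simp add: field_simps)
  qed
  have "g 0 = l\<^sup>2" unfolding g_def
    using assms by (simp add: dist_norm norm_minus_commute flip: power2_norm_eq_inner)
  moreover have "g 1 = l\<^sup>2 / 2" "g 4 = l\<^sup>2 / 2"
    unfolding g_def
    using assms cc[of 0] \<open>dist (c 0) (c 4) = l\<close>
    by (intro inner_of_equilateral; auto simp: dist_commute)+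
  moreover have "g 2 = (2/3) * (l\<^sup>2 / 2 + g 1) - g 0" "g 3 = (2/3) * (l\<^sup>2 / 2 + g 2) - g 1"
      "g 4 = (2/3) * (l\<^sup>2 / 2 + g 3) - g 2"
    using rec[of 0] rec[of 1] rec[of 2] by (simp_all add: eval_nat_numeral)
  ultimately have "l\<^sup>2 = 0" by argo
  then show False using assms(1) by simp
qed

section \<open>Graphs on seven vertices with five missing edges\<close>

text \<open>Here \<open>H\<close> is the set of pairs that are not edges. If some vertex lies on all of them, deleting it
  leaves five mutually adjacent vertices. Otherwise they are two disjoint pairs, and each of
  these can be completed to a triple by one of the two remaining vertices.\<close>

lemma two_missing_edges_on_six_vertices:
  assumes "card W = 6" "card H \<le> 2" "finite H" and HW: "H \<subseteq> {S. S \<subseteq> W \<and> card S = 2}"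
  shows "(\<exists>X Y. X \<subseteq> W \<and> Y \<subseteq> W \<and> X \<inter> Y = {} \<and> card X = 3 \<and> card Y = 3 \<and> (\<forall>u\<in>X. \<forall>w\<in>Y. {u, w} \<notin> H)) \<or>
    (\<exists>X\<subseteq>W. card X = 5 \<and> (\<forall>S\<in>H. \<not> S \<subseteq> X))"
proof -
  have "finite W" using assms(1) by (metis card.infinite zero_neq_numeral)
  show ?thesis
  proof (cases "\<exists>p\<in>W. \<forall>S\<in>H. p \<in> S")
    case True
    then obtain p where "p \<in> W" "\<forall>S\<in>H. p \<in> S" by blast
    then have "W - {p} \<subseteq> W" "card (W - {p}) = 5" "\<forall>S\<in>H. \<not> S \<subseteq> W - {p}"
      using assms by auto
    then show ?thesis by blast
  next
    case False
    have "card H \<noteq> 0" "card H \<noteq> 1"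
    proof -
      have "W \<noteq> {}" using assms(1) by auto
      then show "card H \<noteq> 0" using False \<open>finite H\<close> by auto
      show "card H \<noteq> 1"
      proof
        assume "card H = 1"
        then obtain S where "H = {S}" by (auto simp: card_1_singleton_iff)
        then show False using False HW by (auto simp: card_2_iff)
      qed
    qed
    then have "card H = 2" using assms(2) by simp
    then obtain S T where H: "H = {S, T}" by (auto simp: card_2_iff)
    have ST: "S \<subseteq> W" "T \<subseteq> W" "card S = 2" "card T = 2" "S \<inter> T = {}"
      using False HW H by auto
    have fin: "finite S" "finite T" using ST \<open>finite W\<close> finite_subset by auto
    have "card (W - (S \<union> T)) = 2"
      using ST fin assms(1) by (simp add: card_Diff_subset card_Un_disjoint)
    then obtain t u where tu: "W - (S \<union> T) = {t, u}" "t \<noteq> u" by (auto simp: card_2_iff)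
    then have out: "t \<notin> S \<union> T" "u \<notin> S \<union> T" "t \<in> W" "u \<in> W" by blast+
    then have "card (insert t S) = 3" "card (insert u T) = 3"
      using ST fin by auto
    moreover have "{x, y} \<notin> H" if "x \<in> insert t S" "y \<in> insert u T" for x y
      using that H out ST tu(2) by auto
    moreover have "insert t S \<inter> insert u T = {}" using out tu(2) ST by auto
    ultimately show ?thesis
      using ST out by (intro disjI1 exI[of _ "insert t S"] exI[of _ "insert u T"]) auto
  qed
qed

text \<open>Call the elements of \<open>H\<close> the missing edges. If a vertex \<open>v\<close> is on three of them, at most two
  are left among the other six vertices, which is the situation of the previous lemma. Otherwise
  the missing edges form disjoint paths and cycles. Two of them meet, since seven vertices have no
  room for five disjoint pairs; say \<open>a\<close> - \<open>v\<close> - \<open>b\<close>. The triple \<open>v, a, b\<close> works unless the path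
  extends at both ends to five vertices \<open>c\<close> - \<open>a\<close> - \<open>v\<close> - \<open>b\<close> - \<open>d\<close>. Then \<open>v, b, d\<close> works against
  the remaining vertices other than \<open>a\<close>, unless \<open>d\<close> is on another missing edge, and symmetrically
  for \<open>v, a, c\<close>. As only one missing edge is left to spoil both, it joins \<open>c\<close> to \<open>d\<close> and closes
  a pentagon.\<close>

lemma dense_graph_on_seven_vertices:
  fixes V :: "'a set"
  assumes V: "card V = 7" and H5: "card H = 5" and HV: "H \<subseteq> {S. S \<subseteq> V \<and> card S = 2}"
  obtains (triples) X Y where "X \<subseteq> V" "Y \<subseteq> V" "X \<inter> Y = {}" "card X = 3" "card Y = 3"
      "\<And>u w. u \<in> X \<Longrightarrow> w \<in> Y \<Longrightarrow> {u, w} \<notin> H"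
  | (five) X where "X \<subseteq> V" "card X = 5" "\<And>S. S \<in> H \<Longrightarrow> \<not> S \<subseteq> X"
  | (pentagon) a b c v d e f where "distinct [a, b, c, v, d, e, f]" "V = {a, b, c, v, d, e, f}"
      "H = {{c, a}, {a, v}, {v, b}, {b, d}, {d, c}}"
proof -
  have finV: "finite V" and finH: "finite H" using V H5 by (metis card.infinite zero_neq_numeral)+
  have edge: "x \<in> V" "y \<in> V" "x \<noteq> y" if "{x, y} \<in> H" for x y
    using that HV by (auto simp: card_2_iff doubleton_eq_iff)
  show thesis
  proof (cases "\<exists>v x y z. {v, x} \<in> H \<and> {v, y} \<in> H \<and> {v, z} \<in> H \<and> distinct [x, y, z]")
    case True
    then obtain v x y z where v: "{v, x} \<in> H" "{v, y} \<in> H" "{v, z} \<in> H" "distinct [x, y, z]"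
      by blast
    \<comment> \<open>the missing edges that survive the deletion of \<open>v\<close>\<close>
    define K where "K = {S \<in> H. v \<notin> S}"
    have "card {{v, x}, {v, y}, {v, z}} = 3"
      using v by (simp add: doubleton_eq_iff)
    moreover have "K \<subseteq> H - {{v, x}, {v, y}, {v, z}}" by (auto simp: K_def)
    ultimately have "card K \<le> 2"
      using card_mono[of "H - {{v, x}, {v, y}, {v, z}}" K] v H5 finH by (simp add: card_Diff_subset)
    moreover have "card (V - {v}) = 6" using V edge(1)[OF v(1)] by simp
    moreover have "K \<subseteq> {S. S \<subseteq> V - {v} \<and> card S = 2}" using HV by (auto simp: K_def)
    moreover have "finite K" using finH by (simp add: K_def)
    ultimately consider X Y where "X \<subseteq> V - {v}" "Y \<subseteq> V - {v}" "X \<inter> Y = {}" "card X = 3" "card Y = 3"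
        "\<forall>u\<in>X. \<forall>w\<in>Y. {u, w} \<notin> K"
      | X where "X \<subseteq> V - {v}" "card X = 5" "\<forall>S\<in>K. \<not> S \<subseteq> X"
      using two_missing_edges_on_six_vertices[of "V - {v}" K] by blast
    then show ?thesis
    proof cases
      case 1
      have "{u, w} \<notin> H" if "u \<in> X" "w \<in> Y" for u w
      proof -
        have "{u, w} \<notin> K" "v \<noteq> u" "v \<noteq> w" using 1 that by blast+
        then show ?thesis by (simp add: K_def)
      qed
      then show ?thesis using 1(1-5) by (intro triples[of X Y]) auto
    next
      case 2
      then have "\<not> S \<subseteq> X" if "S \<in> H" for S
        using that by (auto simp: K_def)
      then show ?thesis using 2(1,2) by (intro five[of X]) auto
    qed
  next
    case False
    then have deg: "x = y \<or> x = z \<or> y = z" if "{v, x} \<in> H" "{v, y} \<in> H" "{v, z} \<in> H" for v x y z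
      using that by auto
    have "\<exists>S\<in>H. \<exists>T\<in>H. S \<noteq> T \<and> S \<inter> T \<noteq> {}"
    proof (rule ccontr)
      assume "\<not> ?thesis"
      then have "card (\<Union>H) = sum card H"
        using HV finite_subset[OF _ finV] by (intro card_Union_disjoint) (auto simp: pairwise_def disjnt_def)
      also have "\<dots> = sum (\<lambda>_. 2) H" using HV by (intro sum.cong) auto
      also have "\<dots> = 10" using H5 by simp
      finally show False
        using card_mono[of V "\<Union>H"] HV V finV by auto
    qed
    then obtain S T v where ST: "S \<in> H" "T \<in> H" "S \<noteq> T" "v \<in> S" "v \<in> T" by blast
    have pair: "\<exists>x. U = {v, x}" if "U \<in> H" "v \<in> U" for U
      using that HV by (auto simp: card_2_iff)
    obtain a b where ab: "{v, a} \<in> H" "{v, b} \<in> H" "a \<noteq> b"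
      using pair[of S] pair[of T] ST by metis
    have dist3: "v \<in> V" "a \<in> V" "b \<in> V" "v \<noteq> a" "v \<noteq> b"
      using edge[OF ab(1)] edge[OF ab(2)] by auto
    have v_nbr: "x = a \<or> x = b" if "{v, x} \<in> H" for x
      using deg[OF ab(1) ab(2) that] ab(3) by auto
    show ?thesis
    proof (cases "\<exists>c d. c \<in> V - {v, a, b} \<and> d \<in> V - {v, a, b} \<and> c \<noteq> d \<and> {a, c} \<in> H \<and> {b, d} \<in> H")
      case False
      \<comment> \<open>Since the path does not extend at both ends to distinct vertices, deleting one vertex \<open>c\<close>
        separates \<open>{v, a, b}\<close> from the rest; this covers a 4-cycle as well, with \<open>c\<close> opposite \<open>v\<close>.\<close>
      have "\<exists>c. \<forall>x \<in> V - {v, a, b} - {c}. {a, x} \<notin> H \<and> {b, x} \<notin> H"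
      proof (rule ccontr)
        assume *: "\<not> ?thesis"
        then obtain x where x: "x \<in> V - {v, a, b}" "{a, x} \<in> H \<or> {b, x} \<in> H" by blast
        from * obtain y where y: "y \<in> V - {v, a, b}" "y \<noteq> x" "{a, y} \<in> H \<or> {b, y} \<in> H" by blast
        have "\<not> ({a, x} \<in> H \<and> {a, y} \<in> H)" "\<not> ({b, x} \<in> H \<and> {b, y} \<in> H)"
          using deg[of a x y v] deg[of b x y v] ab x y by (auto simp: insert_commute)
        then show False using False x y by metis
      qed
      then obtain c where c: "\<And>x. x \<in> V - {v, a, b} - {c} \<Longrightarrow> {a, x} \<notin> H \<and> {b, x} \<notin> H" by blast
      have c3: "card {v, a, b} = 3" using ab dist3 by simp
      then have "card (V - {v, a, b}) = 4" using V dist3 by (simp add: card_Diff_subset)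
      then have "3 \<le> card (V - {v, a, b} - {c})" by (simp add: card_Diff_singleton_if)
      then obtain Y where Y: "Y \<subseteq> V - {v, a, b} - {c}" "card Y = 3"
        using obtain_subset_with_card_n by metis
      have "{u, w} \<notin> H" if "u \<in> {v, a, b}" "w \<in> Y" for u w
      proof -
        have w: "w \<in> V - {v, a, b} - {c}" using that Y by blast
        then show ?thesis using that(1) c[OF w] v_nbr[of w] by auto
      qed
      then show ?thesis using c3 Y dist3 by (intro triples[of "{v, a, b}" Y]) auto
    next
      case True
      then obtain c d where cd: "c \<in> V - {v, a, b}" "d \<in> V - {v, a, b}" "c \<noteq> d" "{a, c} \<in> H" "{b, d} \<in> H"
        by blast
      have five: "card {c, a, v, b, d} = 5" using ab dist3 cd by auto
      have "card (V - {c, a, v, b, d}) = 2"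
        using five cd dist3 V by (subst card_Diff_subset) auto
      then obtain e f where ef: "V - {c, a, v, b, d} = {e, f}" "e \<noteq> f" by (auto simp: card_2_iff)
      have V_eq: "V = {a, b, c, v, d, e, f}" using ef(1) cd dist3 by blast
      have ef': "e \<notin> {c, a, v, b, d}" "f \<notin> {c, a, v, b, d}" using ef(1) by blast+
      have dis: "distinct [a, b, c, v, d, e, f]"
        using ef(2) ef' ab dist3 cd by auto
      have a_nbr: "x = v \<or> x = c" if "{a, x} \<in> H" for x
        using deg[of a v c x] that ab cd by (auto simp: insert_commute)
      have b_nbr: "x = v \<or> x = d" if "{b, x} \<in> H" for x
        using deg[of b v d x] that ab cd by (auto simp: insert_commute)
      consider (left) "{d, c} \<notin> H" "{d, e} \<notin> H" "{d, f} \<notin> H"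
        | (right) "{c, d} \<notin> H" "{c, e} \<notin> H" "{c, f} \<notin> H"
        | (closed) "{d, c} \<in> H"
        | (longer) y z where "{d, y} \<in> H" "{c, z} \<in> H" "y \<in> {e, f}" "z \<in> {e, f}"
        by (metis insert_commute insertI1 insertI2)
      then show ?thesis
      proof cases
        case left
        then have "{u, w} \<notin> H" if "u \<in> {v, b, d}" "w \<in> {c, e, f}" for u w
          using that dis v_nbr[of w] b_nbr[of w] by auto
        then show ?thesis using dis V_eq by (intro triples[of "{v, b, d}" "{c, e, f}"]) auto
      next
        case right
        then have "{u, w} \<notin> H" if "u \<in> {v, a, c}" "w \<in> {d, e, f}" for u w
          using that dis v_nbr[of w] a_nbr[of w] by auto
        then show ?thesis using dis V_eq by (intro triples[of "{v, a, c}" "{d, e, f}"]) auto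
      next
        case closed
        let ?C = "{{c, a}, {a, v}, {v, b}, {b, d}, {d, c}}"
        have "?C \<subseteq> H" using ab cd closed by (auto simp: insert_commute)
        moreover have "card ?C = 5" using dis by (simp add: doubleton_eq_iff)
        ultimately have "H = ?C" using H5 finH by (metis card_subset_eq)
        then show ?thesis using pentagon dis V_eq by blast
      next
        case longer
        \<comment> \<open>impossible: extending the path at both ends gives six missing edges\<close>
        let ?C = "{{c, a}, {a, v}, {v, b}, {b, d}, {d, y}, {c, z}}"
        have "?C \<subseteq> H" using ab cd longer by (auto simp: insert_commute)
        moreover have "card ?C = 6" using dis longer by (auto simp: doubleton_eq_iff)
        ultimately show ?thesis using H5 finH card_mono[of H ?C] by simp
      qed
    qed
  qed
qed

section \<open>The contact number of seven spheres\<close>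

lemma contacts_of_seven_spheres_le:
  assumes "sphere_packing 7 x"
  shows "card (touching_pairs 7 x) \<le> 15"
proof (rule ccontr)
  define P where "P = {S. S \<subseteq> {1..7::nat} \<and> card S = 2}"
  assume "\<not> ?thesis"
  then have "16 \<le> card (touching_pairs 7 x)" by simp
  \<comment> \<open>Exactly 16 contacts are selected, to have exactly five missing pairs; a missing pair may
    still be a contact.\<close>
  then obtain T where T: "T \<subseteq> touching_pairs 7 x" "card T = 16"
    by (rule obtain_subset_with_card_n)
  have "touching_pairs 7 x \<subseteq> P" by (auto simp: touching_pairs_def P_def)
  then have TP: "T \<subseteq> P" using T by blast
  have finP: "finite P" by (simp add: P_def)
  have "card P = 21"
    unfolding P_def by (subst n_subsets) (simp_all add: eval_nat_numeral)
  then have card5: "card (P - T) = 5"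
    using TP T(2) finite_subset[OF TP finP] by (simp add: card_Diff_subset)
  have touch: "dist (x i) (x j) = 2" if "{i, j} \<notin> P - T" "i \<in> {1..7}" "j \<in> {1..7}" "i \<noteq> j" for i j
  proof -
    have "{i, j} \<in> touching_pairs 7 x"
      using that T(1) by (auto simp: P_def)
    then show ?thesis by (auto simp: touching_pairs_def doubleton_eq_iff dist_commute)
  qed
  have inj: "x i = x j \<longleftrightarrow> i = j" if "i \<in> {1..7}" "j \<in> {1..7}" for i j
    using assms that unfolding sphere_packing_iff_dist by fastforce
  show False
  proof (rule dense_graph_on_seven_vertices[of "{1..7}" "P - T"])
    show "card {1..7::nat} = 7" "card (P - T) = 5" "P - T \<subseteq> {S. S \<subseteq> {1..7} \<and> card S = 2}"
      using card5 by (auto simp: P_def)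
  next
    fix X Y assume XY: "X \<subseteq> {1..7}" "Y \<subseteq> {1..7}" "X \<inter> Y = {}" "card X = 3" "card Y = 3"
      "\<And>u w. u \<in> X \<Longrightarrow> w \<in> Y \<Longrightarrow> {u, w} \<notin> P - T"
    obtain a b c where X: "X = {a, b, c}" "a \<noteq> b" "a \<noteq> c" "b \<noteq> c" using XY(4) by (auto simp: card_3_iff)
    obtain p q r where Y: "Y = {p, q, r}" "p \<noteq> q" "p \<noteq> r" "q \<noteq> r" using XY(5) by (auto simp: card_3_iff)
    have "dist (x u) (x w) = 2" if "u \<in> X" "w \<in> Y" for u w
      using touch[of u w] XY that by blast
    then show False
      using X Y XY(1,2)
      by (intro no_equidistant_triples[of "x a" "x b" "x c" "x p" "x q" "x r" 2]) (auto simp: inj)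
  next
    fix X assume X: "X \<subseteq> {1..7}" "card X = 5" "\<And>S. S \<in> P - T \<Longrightarrow> \<not> S \<subseteq> X"
    obtain a b c p r where abc: "X = {a, b, c, p, r}" "distinct [a, b, c, p, r]"
    proof -
      have "finite X" using X(1) finite_subset by blast
      then obtain xs where xs: "set xs = X" "distinct xs" using finite_distinct_list by blast
      then have "length xs = 5" using X(2) distinct_card by fastforce
      then obtain a b c p r where "xs = [a, b, c, p, r]" by (auto simp: eval_nat_numeral length_Suc_conv)
      then show ?thesis using that xs by auto
    qed
    have "dist (x u) (x w) = 2" if "u \<in> X" "w \<in> X" "u \<noteq> w" for u w
      using touch[of u w] X that by blast
    then show False
      using no_five_equidistant_points[of 2 "x a" "x b" "x c" "x p" "x r"] abc by auto
  next
    fix a b c v d e f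
    assume dis: "distinct [a, b, c, v, d, e, f]" and V: "{1..7} = {a, b, c, v, d, e, f}"
      and H: "P - T = {{c, a}, {a, v}, {v, b}, {b, d}, {d, c}}"
    \<comment> \<open>the complement of the pentagon \<open>c a v b d\<close> is the pentagon \<open>a b c v d\<close>\<close>
    define y where "y i = x ([a, b, c, v, d] ! i)" for i
    have t: "dist (x i) (x j) = 2" if "{i, j} \<notin> {{c, a}, {a, v}, {v, b}, {b, d}, {d, c}}"
       "i \<in> {a, b, c, v, d, e, f}" "j \<in> {a, b, c, v, d, e, f}" "i \<noteq> j" for i j
      using touch[of i j] that unfolding H V by blast
    have n: "x i \<noteq> x j" if "i \<in> {a, b, c, v, d, e, f}" "j \<in> {a, b, c, v, d, e, f}" "i \<noteq> j" for i j
      using inj[of i j] that unfolding V by blast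
    have "dist (y 0) (y 4) \<noteq> 2"
    proof (rule no_five_tetrahedra_around_edge[where a = "x e" and b = "x f"])
      show "dist (x e) (x f) = 2" using dis by (clarsimp simp: t doubleton_eq_iff)
    next
      fix i :: nat assume "i < 5"
      then consider "i = 0" | "i = 1" | "i = 2" | "i = 3" | "i = 4" by linarith
      then show "dist (x e) (y i) = 2" "dist (x f) (y i) = 2"
        using dis by (cases; clarsimp simp: y_def t doubleton_eq_iff)+
    next
      fix i :: nat assume "i < 4"
      then consider "i = 0" | "i = 1" | "i = 2" | "i = 3" by linarith
      then show "dist (y i) (y (Suc i)) = 2"
        using dis by (cases; clarsimp simp: y_def t doubleton_eq_iff)+
    next
      fix i :: nat assume "i < 3"
      then consider "i = 0" | "i = 1" | "i = 2" by linarith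
      then show "y i \<noteq> y (i + 2)"
        using dis by (cases; clarsimp simp: y_def n numeral_3_eq_3)
    qed simp
    moreover have "dist (y 0) (y 4) = 2"
      using dis by (clarsimp simp: y_def t doubleton_eq_iff)
    ultimately show False by simp
  qed
qed

text \<open>In these coordinates the centres are points of the face-centred cubic lattice, and the cap
  \<open>(1, 1, 1)\<close> lies over the face of the octahedron spanned by the three unit vectors.\<close>

definition capped_octahedron :: "nat \<Rightarrow> real ^ 3" where
  "capped_octahedron i = sqrt 2 *\<^sub>R vector
     (if i = 1 then [1, 0, 0] else if i = 2 then [0, 1, 0] else if i = 3 then [0, 0, 1]
      else if i = 4 then [-1, 0, 0] else if i = 5 then [0, -1, 0] else if i = 6 then [0, 0, -1]
      else [1, 1, 1])"

lemma dist_sqrt2_vector: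
  "dist (sqrt 2 *\<^sub>R vector [a, b, c]) (sqrt 2 *\<^sub>R vector [a', b', c'] :: real ^ 3) =
   sqrt (2 * ((a - a')\<^sup>2 + (b - b')\<^sup>2 + (c - c')\<^sup>2))"
  by (simp add: dist_norm norm_vec_def L2_set_def sum_3
      power_mult_distrib flip: scaleR_diff_right)

lemma capped_octahedron:
  shows "sphere_packing 7 capped_octahedron" "15 \<le> card (touching_pairs 7 capped_octahedron)"
proof -
  let ?x = capped_octahedron
  have s: "{1..7::nat} = {1, 2, 3, 4, 5, 6, 7}" by auto
  note [simp] = dist_sqrt2_vector
  have "2 = sqrt 4" by simp
  then have le: "2 \<le> sqrt z" if "4 \<le> z" for z using that by (simp only: real_sqrt_le_iff)
  show "sphere_packing 7 ?x"
    unfolding sphere_packing_iff_dist s by (simp add: capped_octahedron_def le)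
  let ?E = "{{1, 2}, {1, 3}, {2, 3}, {1, 5}, {1, 6}, {2, 4}, {2, 6}, {3, 4}, {3, 5},
    {4, 5}, {4, 6}, {5, 6}, {7, 1}, {7, 2}, {7, 3}} :: nat set set"
  have pair: "{i, j} \<in> touching_pairs 7 ?x" if "i \<in> {1..7}" "j \<in> {1..7}" "i \<noteq> j" "dist (?x i) (?x j) = 2" for i j
    using that unfolding touching_pairs_def by blast
  have "?E \<subseteq> touching_pairs 7 ?x"
    unfolding insert_subset by (intro conjI pair; simp add: capped_octahedron_def)
  moreover have "card ?E = 15" by (simp add: doubleton_eq_iff)
  moreover have "finite (touching_pairs 7 ?x)"
    by (rule finite_subset[of _ "Pow {1..7}"]) (auto simp: touching_pairs_def)
  ultimately show "15 \<le> card (touching_pairs 7 ?x)" by (metis card_mono)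
qed

theorem theorem3:
  shows "contact_number 7 = 15"
proof -
  have "contact_number 7 \<le> 15"
    unfolding contact_number_def
    by (intro Max.boundedI contact_numbers_finite contact_numbers_nonempty)
       (auto intro: contacts_of_seven_spheres_le)
  moreover have "card (touching_pairs 7 capped_octahedron) \<le> contact_number 7"
    unfolding contact_number_def
    using capped_octahedron(1) by (intro Max_ge contact_numbers_finite) auto
  ultimately show ?thesis using capped_octahedron(2) by linarith
qed

end
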